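(* Suppose that $(S,\circ)$ is a graded anti-pre-Lie algebraic structure on the Witt algebra $\mathcal{W}$. Then there exists $\gamma\in\mathbb{C}$ such that $$W_n\circ W_m=-(\gamma+m+2n)W_{m+n},\qquad \forall m,n\in\mathbb{Z}.$$ Moreover, for any $\gamma\in\mathbb{C}$, the formula $W_n\circ W_m=-(\gamma+m+2n)W_{m+n}$ ($m,n\in\mathbb{Z}$) defines a graded anti-pre-Lie algebraic structure on $\mathcal{W}$.
   Context: All vector spaces and algebras are over $\mathbb{C}$. An anti-pre-Lie algebra is a vector space $A$ with a bilinear operation $\circ$ such that, with $[x,y]=x\circ y-y\circ x$, for all $x,y,z\in A$: $x\circ(y\circ z)-y\circ(x\circ z)=[y,x]\circ z$ and $[[x,y],z]+[[y,z],x]+[[z,x],y]=0$. The commutator $[\cdot,\cdot]$ then is a Lie bracket on $A$, and $(A,\circ)$ is called an anti-pre-Lie algebraic structure on a Lie algebra $\mathfrak{g}$ if the underlying vector space of $\mathfrak g$ is $A$ and the Lie bracket of $\mathfrak g$ is this commutator. The Witt algebra $\mathcal{W}$ is the Lie algebra with basis $\{W_m : m\in\mathbb{Z}\}$ and bracket $[W_m,W_n]=(n-m)W_{m+n}$ for all $m,n\in\mathbb{Z}$. A graded anti-pre-Lie algebraic structure on $\mathcal{W}$, denoted $(S,\circ)$, is an anti-pre-Lie algebraic structure on $\mathcal{W}$ (so $S=\mathcal{W}$ as a vector space) such that $W_m\circ W_n=\varphi(m,n)W_{m+n}$ for all $m,n\in\mathbb{Z}$, for some function $\varphi:\mathbb{Z}\times\mathbb{Z}\to\mathbb{C}$.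 *)

theory Defs
  imports Complex_Main "HOL-Library.Poly_Mapping"
begin

text \<open>The vector spaces here need not be finite-dimensional and carry no norm; they are given by an
  explicit scalar multiplication \<^term>\<open>scale\<close> on an abelian group, as in the locale
  \<^locale>\<open>vector_space\<close>.\<close>

definition bilinear_op ::
  "(complex \<Rightarrow> 'a::ab_group_add \<Rightarrow> 'a) \<Rightarrow> ('a \<Rightarrow> 'a \<Rightarrow> 'a) \<Rightarrow> bool" where
  "bilinear_op scale f \<longleftrightarrow>
     (\<forall>x. Vector_Spaces.linear scale scale (f x)) \<and>
     (\<forall>y. Vector_Spaces.linear scale scale (\<lambda>x. f x y))"

definition commutator :: "('a::ab_group_add \<Rightarrow> 'a \<Rightarrow> 'a) \<Rightarrow> 'a \<Rightarrow> 'a \<Rightarrow> 'a" where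
  "commutator f x y = f x y - f y x"

locale lie_algebra = vector_space scale
  for scale :: "complex \<Rightarrow> 'a::ab_group_add \<Rightarrow> 'a" +
  fixes bracket :: "'a \<Rightarrow> 'a \<Rightarrow> 'a"
  assumes bilinear_bracket: "bilinear_op scale bracket"
    and bracket_self: "bracket x x = 0"
    and jacobi: "bracket (bracket x y) z + bracket (bracket y z) x + bracket (bracket z x) y = 0"

locale anti_pre_lie_algebra = vector_space scale
  for scale :: "complex \<Rightarrow> 'a::ab_group_add \<Rightarrow> 'a" +
  fixes circ :: "'a \<Rightarrow> 'a \<Rightarrow> 'a"
  assumes bilinear_circ: "bilinear_op scale circ"
    and anti_pre_lie: "circ x (circ y z) - circ y (circ x z) = circ (commutator circ y x) z"
    and commutator_jacobi:
      "commutator circ (commutator circ x y) z + commutator circ (commutator circ y z) x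
        + commutator circ (commutator circ z x) y = 0"

definition anti_pre_lie_structure_on ::
  "(complex \<Rightarrow> 'a::ab_group_add \<Rightarrow> 'a) \<Rightarrow> ('a \<Rightarrow> 'a \<Rightarrow> 'a) \<Rightarrow> ('a \<Rightarrow> 'a \<Rightarrow> 'a) \<Rightarrow> bool" where
  "anti_pre_lie_structure_on scale bracket circ \<longleftrightarrow>
     lie_algebra scale bracket \<and> anti_pre_lie_algebra scale circ \<and>
     (\<forall>x y. bracket x y = commutator circ x y)"

text \<open>Any complex Lie algebra with a distinguished basis $(W_m)_{m \in Z}$ that satisfies the Witt
  relations; this determines the bracket, and hence the Lie algebra up to isomorphism. Injectivity
  of \<^term>\<open>W\<close> is needed since \<^term>\<open>independent\<close> only speaks about the set of basis vectors.\<close>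

locale witt_algebra = lie_algebra scale bracket
  for scale :: "complex \<Rightarrow> 'a::ab_group_add \<Rightarrow> 'a" and bracket :: "'a \<Rightarrow> 'a \<Rightarrow> 'a" +
  fixes W :: "int \<Rightarrow> 'a"
  assumes inj_W: "inj W"
    and independent_W: "independent (range W)"
    and span_W: "span (range W) = UNIV"
    and bracket_W: "bracket (W m) (W n) = scale (of_int (n - m)) (W (m + n))"

definition graded_anti_pre_lie_structure_on ::
  "(complex \<Rightarrow> 'a::ab_group_add \<Rightarrow> 'a) \<Rightarrow> ('a \<Rightarrow> 'a \<Rightarrow> 'a) \<Rightarrow> (int \<Rightarrow> 'a) \<Rightarrow> ('a \<Rightarrow> 'a \<Rightarrow> 'a) \<Rightarrow> bool" where
  "graded_anti_pre_lie_structure_on scale bracket W circ \<longleftrightarrow>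
     anti_pre_lie_structure_on scale bracket circ \<and>
     (\<exists>\<phi> :: int \<times> int \<Rightarrow> complex. \<forall>m n. circ (W m) (W n) = scale (\<phi> (m, n)) (W (m + n)))"

text \<open>The Witt algebra exists: on Laurent polynomials (finitely supported functions with the
  convolution product), with \<^term>\<open>W m\<close> the monomial $t^m$ and $D = t \frac{d}{dt}$, the bracket
  $f \cdot D g - D f \cdot g$ satisfies the Witt relations.\<close>

definition laurent_scale :: "complex \<Rightarrow> (int \<Rightarrow>\<^sub>0 complex) \<Rightarrow> (int \<Rightarrow>\<^sub>0 complex)" where
  "laurent_scale c f = Poly_Mapping.single 0 c * f"

definition laurent_D :: "(int \<Rightarrow>\<^sub>0 complex) \<Rightarrow> (int \<Rightarrow>\<^sub>0 complex)" where
  "laurent_D = Poly_Mapping.mapp (\<lambda>k c. of_int k * c)"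

lemma lookup_laurent_D: "Poly_Mapping.lookup (laurent_D f) k = of_int k * Poly_Mapping.lookup f k"
  by (simp add: laurent_D_def lookup_mapp in_keys_iff when_def)

lemma laurent_D_add: "laurent_D (f + g) = laurent_D f + laurent_D g"
  by (rule poly_mapping_eqI) (simp add: lookup_laurent_D lookup_add algebra_simps)

lemma laurent_D_diff: "laurent_D (f - g) = laurent_D f - laurent_D g"
  by (rule poly_mapping_eqI) (simp add: lookup_laurent_D lookup_minus algebra_simps)

lemma laurent_D_single:
  "laurent_D (Poly_Mapping.single k c) = Poly_Mapping.single k (of_int k * c)"
  by (rule poly_mapping_eqI) (simp add: lookup_laurent_D lookup_single when_def)

lemma laurent_induct [case_names single add]:
  assumes "\<And>k c. P (Poly_Mapping.single k c)" "\<And>f g. P f \<Longrightarrow> P g \<Longrightarrow> P (f + g)"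
  shows "P (f :: int \<Rightarrow>\<^sub>0 complex)"
proof (induction f rule: update_induct)
  case const
  show ?case using assms(1)[of 0 0] by simp
next
  case (update f a b)
  have "Poly_Mapping.update a b f = f + Poly_Mapping.single a b"
    using update(1) by (intro poly_mapping_eqI)
      (auto simp: lookup_update lookup_add lookup_single in_keys_iff when_def)
  then show ?case using assms update by metis
qed

lemma laurent_D_mult: "laurent_D (f * g) = laurent_D f * g + f * laurent_D g"
proof (induction f rule: laurent_induct)
  case (single k c)
  show ?case
  proof (induction g rule: laurent_induct)
    case (single l d)
    show ?case
      by (simp add: mult_single laurent_D_single flip: single_add) (simp add: algebra_simps)
  qed (simp add: laurent_D_add algebra_simps)
qed (simp add: laurent_D_add algebra_simps)

lemma laurent_D_scale: "laurent_D (laurent_scale c f) = laurent_scale c (laurent_D f)"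
  by (simp add: laurent_scale_def laurent_D_mult laurent_D_single)

lemma vector_space_laurent: "vector_space laurent_scale"
  by unfold_locales
    (simp_all add: laurent_scale_def algebra_simps single_add mult_single flip: mult.assoc)

lemma witt_algebra_exists:
  "witt_algebra laurent_scale (\<lambda>f g. f * laurent_D g - laurent_D f * g)
     (\<lambda>m. Poly_Mapping.single m 1)"
proof -
  interpret vector_space laurent_scale by (rule vector_space_laurent)
  let ?W = "\<lambda>m::int. Poly_Mapping.single m (1::complex)"
  have inj: "inj ?W"
    by (rule injI) (metis lookup_single_eq lookup_single_not_eq zero_neq_one)
  have scale_W: "laurent_scale c (?W m) = Poly_Mapping.single m c" for c m
    by (simp add: laurent_scale_def mult_single)
  have lookup_sum': "Poly_Mapping.lookup (\<Sum>k\<in>K. Poly_Mapping.single k (u k)) l = u l"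
    if "finite K" "l \<in> K" for K :: "int set" and u :: "int \<Rightarrow> complex" and l
    using that by (simp add: lookup_sum lookup_single when_def)
  have indep: "independent (range ?W)"
    unfolding independent_explicit_module
  proof (intro allI impI)
    fix t u v
    assume t: "finite t" "t \<subseteq> range ?W" "(\<Sum>v\<in>t. laurent_scale (u v) v) = 0" "v \<in> t"
    then obtain K where K: "t = ?W ` K" by (auto simp: subset_image_iff)
    have injK: "inj_on ?W K" using inj by (rule inj_on_subset) simp
    have fin: "finite K" using t(1) K injK finite_imageD by blast
    obtain l where l: "l \<in> K" "v = ?W l" using t(4) K by blast
    have "(\<Sum>k\<in>K. Poly_Mapping.single k (u (?W k))) = 0"
      using t(3) K sum.reindex[OF injK, of "\<lambda>v. laurent_scale (u v) v"] by (simp add: scale_W)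
    then show "u v = 0"
      using lookup_sum'[OF fin l(1), of "\<lambda>k. u (?W k)"] l(2) by simp
  qed
  have "f \<in> span (range ?W)" for f
  proof (induction f rule: laurent_induct)
    case (single k c)
    have "laurent_scale c (?W k) \<in> span (range ?W)"
      by (intro span_scale span_base rangeI)
    then show ?case by (simp only: scale_W)
  next
    case (add f g)
    then show ?case by (rule span_add)
  qed
  then have span: "span (range ?W) = UNIV" by blast
  show ?thesis
  proof (intro witt_algebra.intro lie_algebra.intro lie_algebra_axioms.intro
      witt_algebra_axioms.intro vector_space_laurent inj indep span)
    show "bilinear_op laurent_scale (\<lambda>f g. f * laurent_D g - laurent_D f * g)"
      unfolding bilinear_op_def Vector_Spaces.linear_iff
      by (simp add: vector_space_laurent laurent_D_add laurent_D_scale)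
        (simp add: laurent_scale_def algebra_simps)
  next
    fix m n :: int
    show "?W m * laurent_D (?W n) - laurent_D (?W m) * ?W n
        = laurent_scale (of_int (n - m)) (?W (m + n))"
      by (simp add: laurent_D_single scale_W mult_single flip: single_diff)
  qed (simp_all add: laurent_D_mult laurent_D_diff algebra_simps)
qed

end

theory Submission
  imports Defs
begin

text \<open>Write \<open>W m \<circ> W n = \<phi> m n W (m + n)\<close>. The anti-pre-Lie identity with \<open>W 0\<close> as first factor
  says that \<open>\<phi> n l \<noteq> 0\<close> forces \<open>\<phi> 0 (n + l) = \<phi> 0 l - n\<close>. Since \<open>\<phi> n l - \<phi> l n = l - n\<close>, one of
  \<open>\<phi> n l\<close>, \<open>\<phi> l n\<close> is nonzero whenever \<open>n \<noteq> l\<close>, and this propagates \<open>\<phi> 0 n = \<phi> 0 0 - n\<close> to all \<open>n\<close>.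
  The identity applied to \<open>W 0\<close> then determines \<open>\<phi>\<close> off the diagonal, and applied to \<open>W n\<close> it
  determines \<open>\<phi> n n\<close>. For the converse, all identities are multilinear and hence need only be
  checked on the basis.\<close>

lemma graded_coefficients_unique:
  fixes \<phi> :: "int \<Rightarrow> int \<Rightarrow> 'b::field_char_0"
  assumes comm: "\<And>m n. \<phi> m n - \<phi> n m = of_int (n - m)"
    and apl: "\<And>m n l. \<phi> n l * \<phi> m (n + l) - \<phi> m l * \<phi> n (m + l) = of_int (m - n) * \<phi> (m + n) l"
  shows "\<phi> m n = \<phi> 0 0 - of_int n - 2 * of_int m"
proof -
  \<comment> \<open>\<open>h\<close> removes the expected slope from \<open>\<phi> 0 n\<close>, so
    the first goal is that \<open>h\<close> is constant.\<close>
  define h where "h n = \<phi> 0 n + of_int n" for n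
  have right_0: "\<phi> n 0 = h n - 2 * of_int n" for n
    using comm[of n 0] by (simp add: h_def algebra_simps)
  have h_shift: "\<phi> n l = 0 \<or> h (n + l) = h l" for n l
  proof -
    have "\<phi> n l * (h (n + l) - h l) = 0"
      using apl[of n l 0] by (simp add: h_def algebra_simps)
    then show ?thesis by simp
  qed
  have h_cases: "h n = 2 * of_int n \<or> h n = h 0" for n
    using h_shift[of n 0] right_0[of n] by auto
  have h_add: "h (n + l) = h l \<or> h (n + l) = h n" if "n \<noteq> l" for n l
  proof -
    have "\<phi> n l \<noteq> 0 \<or> \<phi> l n \<noteq> 0"
      using comm[of n l] that by auto
    then show ?thesis
      using h_shift[of n l] h_shift[of l n] by (auto simp: add.commute)
  qed
  have h_const: "h k = h 0" for k
  proof (rule ccontr)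
    assume k: "h k \<noteq> h 0"
    \<comment> \<open>Stepping from \<open>k\<close> one further away from 0 splits \<open>k\<close>
      into distinct nonzero summands \<open>n\<close> and \<open>k - n\<close>. By
      \<open>h_add\<close> one of them shares the exceptional value \<open>2 * k\<close> of
      \<open>h k\<close>, while \<open>h_cases\<close> allows a summand only twice itself as
      exceptional value.\<close>
    define n where "n = (if k < 0 then k - 1 else k + 1)"
    have n: "n \<noteq> 0" "n \<noteq> k" "n \<noteq> k - n"
      using k by (auto simp: n_def)
    have "h k = h (k - n) \<or> h k = h n"
      using h_add[OF n(3)] by simp
    then have "h k = 2 * of_int (k - n) \<or> h k = 2 * of_int n"
      using k h_cases[of "k - n"] h_cases[of n] by argo
    then have "2 * of_int k = (2 * of_int (k - n) :: 'b) \<or> 2 * of_int k = (2 * of_int n :: 'b)"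
      using k h_cases[of k] by argo
    then have "k = k - n \<or> k = n"
      by (simp only: mult_cancel_left of_int_eq_iff) simp
    then show False
      using n by simp
  qed
  have off_diagonal: "\<phi> m n = h 0 - of_int n - 2 * of_int m" if "m \<noteq> n" for m n
  proof -
    have nm: "\<phi> n m = \<phi> m n - of_int (n - m)"
      using comm[of m n] by (simp add: algebra_simps)
    \<comment> \<open>With \<open>l = 0\<close> the coefficients with second argument 0 are known
      from \<open>right_0\<close>. Eliminating \<open>\<phi> n m\<close> by \<open>nm\<close> leaves
      a linear equation for \<open>\<phi> m n\<close>.\<close>
    have "2 * of_int (m - n) * (\<phi> m n - (h 0 - of_int n - 2 * of_int m)) = 0"
      using apl[of n 0 m] h_const[of n] h_const[of m] h_const[of "m + n"]
      by (simp add: right_0 nm algebra_simps)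
    moreover have "of_int (m - n) \<noteq> (0::'b)"
      using that by (simp only: of_int_eq_0_iff)
    ultimately show ?thesis by simp
  qed
  have diagonal: "\<phi> n n = h 0 - of_int n - 2 * of_int n" if n: "n \<noteq> 0" for n
  proof -
    \<comment> \<open>When \<open>l = n\<close>, the unknown \<open>\<phi> n n\<close> has the
      factor \<open>\<phi> m (2 * n)\<close>. The first three conditions make all other coefficients
      off-diagonal, the fourth makes this factor nonzero. At \<open>- n\<close> and
      \<open>3 * n\<close> the factor is \<open>h 0\<close> and \<open>h 0 - 8 * n\<close>, which
      cannot both vanish.\<close>
    obtain m where m: "m \<noteq> 0" "m \<noteq> n" "m \<noteq> 2 * n" "h 0 - 2 * of_int n - 2 * of_int m \<noteq> 0"
    proof (cases "h 0 - 2 * of_int n - 2 * of_int (- n) = 0")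
      case True
      then have "h 0 - 2 * of_int n - 2 * of_int (3 * n) \<noteq> 0"
        using n by auto
      then show ?thesis using that[of "3 * n"] n by auto
    next
      case False
      then show ?thesis using that[of "- n"] n by auto
    qed
    have "(h 0 - 2 * of_int n - 2 * of_int m) * (\<phi> n n - (h 0 - of_int n - 2 * of_int n)) = 0"
      using apl[of n n m] m by (simp add: off_diagonal algebra_simps)
    then show ?thesis using m(4) by simp
  qed
  have "\<phi> m n = h 0 - of_int n - 2 * of_int m"
    using off_diagonal diagonal by (cases "m = n"; cases "m = 0") (auto simp: h_def)
  then show ?thesis by (simp add: h_def)
qed

lemma bilinear_op_iff:
  "bilinear_op scale f \<longleftrightarrow> vector_space scale \<and>
     (\<forall>x y z. f (x + y) z = f x z + f y z) \<and> (\<forall>x y z. f x (y + z) = f x y + f x z) \<and>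
     (\<forall>c x y. f (scale c x) y = scale c (f x y)) \<and> (\<forall>c x y. f x (scale c y) = scale c (f x y))"
  unfolding bilinear_op_def Vector_Spaces.linear_iff by blast

lemma bilinear_op_commutator:
  assumes "bilinear_op scale f"
  shows "bilinear_op scale (commutator f)"
proof -
  interpret vector_space scale using assms by (simp add: bilinear_op_iff)
  show ?thesis
    using assms by (simp add: bilinear_op_iff commutator_def scale_right_diff_distrib)
qed

text \<open>Isolates the linear algebra of a basis given as an injective family, so that values can
  be prescribed by index.\<close>

locale indexed_basis = vector_space scale
  for scale :: "complex \<Rightarrow> 'a::ab_group_add \<Rightarrow> 'a" +
  fixes B :: "'i \<Rightarrow> 'a"
  assumes inj: "inj B" and indep: "independent (range B)" and spans: "span (range B) = UNIV"
begin

lemma basis_induct [case_names base add scale]: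
  assumes "\<And>i. P (B i)" "\<And>x y. P x \<Longrightarrow> P y \<Longrightarrow> P (x + y)" "\<And>c x. P x \<Longrightarrow> P (scale c x)"
  shows "P x"
proof -
  \<comment> \<open>The index type is inhabited, so 0 arises as the zero multiple of some
    \<open>B i\<close>.\<close>
  have "P 0"
    using assms(3)[OF assms(1), of 0] by simp
  then have "subspace (Collect P)"
    using assms(2,3) by (simp add: subspace_def)
  moreover have "x \<in> span (range B)"
    by (simp add: spans)
  ultimately show ?thesis
    using span_induct[of x "range B" P] assms(1) by auto
qed

lemma linear_extension:
  "\<exists>f. Vector_Spaces.linear scale scale f \<and> (\<forall>i. f (B i) = u i)"
proof -
  interpret vector_space_pair scale scale ..
  obtain f where f: "Vector_Spaces.linear scale scale f" "\<forall>x\<in>range B. f x = u (inv B x)"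
    using linear_independent_extend[OF indep, of "\<lambda>x. u (inv B x)"] by (elim exE conjE)
  show ?thesis
    by (rule exI[of _ f]) (simp add: f inj)
qed

lemma bilinear_eqI:
  assumes "bilinear_op scale f" "bilinear_op scale g" "\<And>i j. f (B i) (B j) = g (B i) (B j)"
  shows "f = g"
proof (intro ext)
  fix x y
  show "f x y = g x y"
  proof (induction x rule: basis_induct)
    case (base i)
    show ?case
      by (induction y rule: basis_induct) (use assms in \<open>simp_all add: bilinear_op_iff\<close>)
  qed (use assms in \<open>simp_all add: bilinear_op_iff\<close>)
qed

text \<open>Two linear extensions in turn: \<open>L i\<close> extends \<open>u i\<close> in the
  second argument, then \<open>R y\<close> extends the values \<open>L i y\<close> in the
  first.\<close>

lemma bilinear_extension:
  "\<exists>f. bilinear_op scale f \<and> (\<forall>i j. f (B i) (B j) = u i j)"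
proof -
  define L where "L i = (SOME l. Vector_Spaces.linear scale scale l \<and> (\<forall>j. l (B j) = u i j))" for i
  have L: "Vector_Spaces.linear scale scale (L i)" "L i (B j) = u i j" for i j
    using someI_ex[OF linear_extension[of "u i"]] by (simp_all add: L_def)
  define R where
    "R y = (SOME r. Vector_Spaces.linear scale scale r \<and> (\<forall>i. r (B i) = L i y))" for y
  have R: "Vector_Spaces.linear scale scale (R y)" "R y (B i) = L i y" for y i
    using someI_ex[OF linear_extension[of "\<lambda>i. L i y"]] by (simp_all add: R_def)
  have left: "R y (x + x') = R y x + R y x'" "R y (scale c x) = scale c (R y x)" for y x x' c
    using R(1) by (simp_all add: Vector_Spaces.linear_iff)
  have L': "L i (x + x') = L i x + L i x'" "L i (scale c x) = scale c (L i x)" for i x x' c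
    using L(1) by (simp_all add: Vector_Spaces.linear_iff)
  \<comment> \<open>The maps \<open>R y\<close> are chosen separately for each \<open>y\<close>, so
    linearity in \<open>y\<close> must be traced back to the linearity of \<open>L i\<close> by
    induction on \<open>x\<close>.\<close>
  have "R (y + y') x = R y x + R y' x" for x y y'
    by (induction x rule: basis_induct)
      (simp_all add: R(2) L' left scale_right_distrib algebra_simps)
  moreover have "R (scale c y) x = scale c (R y x)" for c x y
    by (induction x rule: basis_induct)
      (simp_all add: R(2) L' left scale_right_distrib scale_left_commute)
  ultimately have "bilinear_op scale (\<lambda>x y. R y x)"
    using vector_space_axioms left by (simp add: bilinear_op_iff)
  then show ?thesis
    using R(2) L(2) by (intro exI[of _ "\<lambda>x y. R y x"]) simp
qed

text \<open>An independent set does not contain 0. This allows comparing coefficients of a single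
  basis vector.\<close>

lemma scale_basis_eq_iff: "scale a (B i) = scale b (B i) \<longleftrightarrow> a = b"
  using indep dependent_zero[of "range B"] by (metis rangeI scale_cancel_right)

end

sublocale witt_algebra \<subseteq> indexed_basis scale W
  by unfold_locales (fact inj_W independent_W span_W)+

context witt_algebra
begin

lemma graded_structure_coefficients:
  assumes "graded_anti_pre_lie_structure_on scale bracket W circ"
  shows "\<exists>\<gamma>::complex. \<forall>m n.
    circ (W n) (W m) = scale (- (\<gamma> + of_int m + 2 * of_int n)) (W (m + n))"
proof -
  obtain \<psi> :: "int \<times> int \<Rightarrow> complex"
    where \<psi>: "\<And>m n. circ (W m) (W n) = scale (\<psi> (m, n)) (W (m + n))"
      and apl: "anti_pre_lie_algebra scale circ" and br: "\<And>x y. bracket x y = commutator circ x y"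
    using assms unfolding graded_anti_pre_lie_structure_on_def anti_pre_lie_structure_on_def
    by metis
  interpret A: anti_pre_lie_algebra scale circ by (fact apl)
  define \<phi> where "\<phi> m n = \<psi> (m, n)" for m n
  have circ: "circ (W m) (W n) = scale (\<phi> m n) (W (m + n))" for m n
    by (simp add: \<psi> \<phi>_def)
  have lin: "circ x (scale c y) = scale c (circ x y)" "circ (scale c x) y = scale c (circ x y)"
    for c x y
    using A.bilinear_circ by (simp_all add: bilinear_op_iff)
  have "\<phi> m n - \<phi> n m = of_int (n - m)" for m n
  proof -
    have "scale (\<phi> m n - \<phi> n m) (W (m + n)) = scale (of_int (n - m)) (W (m + n))"
      using bracket_W[of m n] unfolding br commutator_def circ
      by (simp add: scale_left_diff_distrib add.commute)
    then show ?thesis by (simp only: scale_basis_eq_iff)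
  qed
  moreover have "\<phi> n l * \<phi> m (n + l) - \<phi> m l * \<phi> n (m + l) = of_int (m - n) * \<phi> (m + n) l" for m n l
  proof -
    have "circ (commutator circ (W n) (W m)) (W l)
        = scale (of_int (m - n) * \<phi> (m + n) l) (W (m + n + l))"
      unfolding br[symmetric] bracket_W lin circ by (simp add: add.commute)
    then have "scale (\<phi> n l * \<phi> m (n + l) - \<phi> m l * \<phi> n (m + l)) (W (m + n + l))
        = scale (of_int (m - n) * \<phi> (m + n) l) (W (m + n + l))"
      using A.anti_pre_lie[of "W m" "W n" "W l"]
      by (simp add: lin circ scale_left_diff_distrib ac_simps)
    then show ?thesis by (simp only: scale_basis_eq_iff)
  qed
  ultimately have \<phi>: "\<phi> n m = \<phi> 0 0 - of_int m - 2 * of_int n" for m n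
    by (rule graded_coefficients_unique)
  \<comment> \<open>The parameter is \<gamma> = \<open>- \<phi> 0 0\<close>, read off from
    \<open>W 0 \<circ> W 0\<close>.\<close>
  have "circ (W n) (W m) = scale (- (- \<phi> 0 0 + of_int m + 2 * of_int n)) (W (m + n))" for m n
    using circ[of n m] by (simp add: \<phi>[of n m] add.commute)
  then show ?thesis by (intro exI[of _ "- \<phi> 0 0"]) simp
qed

lemma graded_structureI:
  fixes \<gamma> :: complex
  assumes bil: "bilinear_op scale circ"
    and circ: "\<And>m n. circ (W n) (W m) = scale (- (\<gamma> + of_int m + 2 * of_int n)) (W (m + n))"
  shows "graded_anti_pre_lie_structure_on scale bracket W circ"
proof -
  have lin: "circ x (scale c y) = scale c (circ x y)" "circ (scale c x) y = scale c (circ x y)"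
    "circ (x + x') y = circ x y + circ x' y" "circ x (y + y') = circ x y + circ x y'" for c x y x' y'
    using bil by (simp_all add: bilinear_op_iff)
  \<comment> \<open>On basis vectors \<gamma> cancels in the commutator, leaving the Witt
    coefficient \<open>n - m\<close>.\<close>
  have br: "bracket = commutator circ"
  proof (rule bilinear_eqI[OF bilinear_bracket bilinear_op_commutator[OF bil]])
    fix m n
    have "commutator circ (W m) (W n) = scale (- (\<gamma> + of_int n + 2 * of_int m)
        - (- (\<gamma> + of_int m + 2 * of_int n))) (W (m + n))"
      unfolding commutator_def circ scale_left_diff_distrib by (simp add: add.commute)
    also have "\<dots> = bracket (W m) (W n)"
      unfolding bracket_W by (rule arg_cong2[of _ _ _ _ scale]) simp_all
    finally show "bracket (W m) (W n) = commutator circ (W m) (W n)" ..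
  qed
  have blin: "bracket x (scale c y) = scale c (bracket x y)"
    "bracket (scale c x) y = scale c (bracket x y)"
    "bracket (x + x') y = bracket x y + bracket x' y"
    "bracket x (y + y') = bracket x y + bracket x y'" for c x y x' y'
    using bilinear_bracket by (simp_all add: bilinear_op_iff)
  \<comment> \<open>Both sides are trilinear; on basis vectors the claim is a polynomial identity in
    \<gamma>, \<open>m\<close>, \<open>n\<close>, \<open>l\<close>.\<close>
  have "circ x (circ y z) - circ y (circ x z) = circ (bracket y x) z" for x y z
  proof (induction x rule: basis_induct)
    case (base m)
    show ?case
    proof (induction y rule: basis_induct)
      case (base n)
      show ?case
      proof (induction z rule: basis_induct)
        case (base l)
        show ?case
          unfolding circ bracket_W lin scale_scale
          by (simp add: ac_simps flip: scale_left_diff_distrib) (simp add: algebra_simps)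
      qed (simp_all add: lin flip: scale_right_diff_distrib, simp add: algebra_simps)
    qed (simp_all add: lin blin flip: scale_right_diff_distrib, simp add: algebra_simps)
  qed (simp_all add: lin blin flip: scale_right_diff_distrib, simp add: algebra_simps)
  \<comment> \<open>The Jacobi identity for the commutator is inherited from \<open>bracket\<close>
    through \<open>br\<close>.\<close>
  then have "anti_pre_lie_algebra scale circ"
    using bil jacobi by unfold_locales (simp_all add: br)
  moreover have "\<exists>\<phi>::int \<times> int \<Rightarrow> complex. \<forall>m n. circ (W m) (W n) = scale (\<phi> (m, n)) (W (m + n))"
    by (rule exI[of _ "\<lambda>(m, n). - (\<gamma> + of_int n + 2 * of_int m)"]) (simp add: circ add.commute)
  ultimately show ?thesis
    unfolding graded_anti_pre_lie_structure_on_def anti_pre_lie_structure_on_def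
    using lie_algebra_axioms br by simp
qed

end

text \<open>The formula fixes values only on basis vectors; the \<open>\<exists>!\<close> clause
  gives the precise sense in which it defines an operation on the whole space.\<close>

theorem theorem3p10:
  fixes scale :: "complex \<Rightarrow> 'a::ab_group_add \<Rightarrow> 'a"
    and bracket :: "'a \<Rightarrow> 'a \<Rightarrow> 'a"
    and W :: "int \<Rightarrow> 'a"
  assumes "witt_algebra scale bracket W"
  shows
    "(\<forall>circ. graded_anti_pre_lie_structure_on scale bracket W circ \<longrightarrow>
        (\<exists>\<gamma>::complex. \<forall>m n.
          circ (W n) (W m) = scale (- (\<gamma> + of_int m + 2 * of_int n)) (W (m + n)))) \<and>
     (\<forall>\<gamma>::complex.
        (\<exists>!circ. bilinear_op scale circ \<and>
          (\<forall>m n. circ (W n) (W m) = scale (- (\<gamma> + of_int m + 2 * of_int n)) (W (m + n)))) \<and>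
        (\<forall>circ. bilinear_op scale circ \<and>
          (\<forall>m n. circ (W n) (W m) = scale (- (\<gamma> + of_int m + 2 * of_int n)) (W (m + n))) \<longrightarrow>
          graded_anti_pre_lie_structure_on scale bracket W circ))"
proof -
  interpret witt_algebra scale bracket W by (fact assms)
  have "\<exists>!circ. bilinear_op scale circ \<and>
      (\<forall>m n. circ (W n) (W m) = scale (- (\<gamma> + of_int m + 2 * of_int n)) (W (m + n)))"
    for \<gamma> :: complex
  proof (rule ex_ex1I)
    obtain f where f: "bilinear_op scale f"
      "\<forall>n m. f (W n) (W m) = scale (- (\<gamma> + of_int m + 2 * of_int n)) (W (m + n))"
      using bilinear_extension[of "\<lambda>n m. scale (- (\<gamma> + of_int m + 2 * of_int n)) (W (m + n))"]
      by (elim exE conjE)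
    show "\<exists>circ. bilinear_op scale circ \<and>
        (\<forall>m n. circ (W n) (W m) = scale (- (\<gamma> + of_int m + 2 * of_int n)) (W (m + n)))"
      by (rule exI[of _ f]) (simp add: f)
  qed (auto intro: bilinear_eqI)
  then show ?thesis
    using graded_structure_coefficients graded_structureI by blast
qed

end
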